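(* Let $\mathcal{H}=\mathcal{H}_1$ be a (uniformly convex) real Hilbert space, $\mathcal{H}_2$ a real Hilbert space, $g_1:\mathcal{H}_1\to\mathcal{H}_1$ a $\mu$-inverse strongly monotone mapping, $g_2:\mathcal{H}_2\to\mathcal{H}_2$ a $\nu$-inverse strongly monotone mapping ($\mu,\nu>0$), $\mathcal{B}_1:\mathcal{H}_1\to 2^{\mathcal{H}_1}$ and $\mathcal{B}_2:\mathcal{H}_2\to 2^{\mathcal{H}_2}$ maximal monotone mappings, and $\mathcal{A}:\mathcal{H}_1\to\mathcal{H}_2$ a bounded linear operator with adjoint $\mathcal{A}^*$. Let $\lambda>0$, $\gamma\in\left(0,\frac{2}{\|\mathcal{A}^*\mathcal{A}\|}\right)$ and put $$\mathcal{U}=\mathfrak{J}^{\mathcal{B}_1}_\lambda(I-\lambda g_1),\quad \mathcal{V}=\mathfrak{J}^{\mathcal{B}_2}_\lambda(I-\lambda g_2),\quad \mathfrak{J}'=\mathcal{U}\,(I+\gamma\mathcal{A}^*(\mathcal{V}-I)\mathcal{A}).$$ Suppose that $\mathcal{S}:\mathcal{H}\to\mathcal{H}$ and $\mathfrak{J}':\mathcal{H}\to\mathcal{H}$ are nonexpansive, that $\Sigma=\mathcal{F}(\mathcal{S})\cap\Omega\neq\emptyset$, and that $\mathcal{S}$ is semicompact. Let $x_0,x_1\in\mathcal{H}$ and let $\{x_n\}$ be generated, for $n\ge 1$, by $$w_n=x_n+\theta_n(x_n-x_{n-1}),\quad y_n=(1-\beta_n)w_n+\beta_n\mathcal{S}w_n,\quad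 x_{n+1}=(1-\alpha_n)\mathcal{S}y_n+\alpha_n\mathfrak{J}'y_n,$$ where: (D1) $\sum_{n=1}^{\infty}\theta_n<\infty$ and $\{\theta_n\}\subset[0,\theta]$ for some $0\le\theta<1$; (D2) $\{\alpha_n\},\{\beta_n\}\subset[\delta,1-\delta]$ for some $\delta\in(0,0.5)$; (D3) $\{\mathcal{S}(w_n)-w_n\}$ and $\{\mathcal{S}(w_n)-x^*\}$ are bounded for any $x^*\in\Sigma$; (D4) $\{\mathfrak{J}'(w_n)-w_n\}$ and $\{\mathfrak{J}'(w_n)-x^*\}$ are bounded for any $x^*\in\Sigma$. Then $\{x_n\}$ converges strongly to a common fixed point of $\mathcal{S}$ and $\mathfrak{J}'$.
   Context: A mapping $\mathcal{S}:\mathcal{H}\to\mathcal{H}$ is nonexpansive if $\|\mathcal{S}x-\mathcal{S}y\|\le\|x-y\|$ for all $x,y$; $\mathcal{F}(\mathcal{S})=\{x\in\mathcal{H}:\mathcal{S}x=x\}$. A mapping $g$ is $\beta$-inverse strongly monotone ($\beta>0$) if $\langle g(x)-g(y),x-y\rangle\ge\beta\|g(x)-g(y)\|^2$ for all $x,y$. A set-valued $\mathcal{M}:\mathcal{H}\to2^{\mathcal{H}}$ is monotone if $\langle x-y,u-v\rangle\ge0$ whenever $u\in\mathcal{M}(x)$, $v\in\mathcal{M}(y)$, and maximal monotone if moreover its graph is not properly contained in the graph of another monotone set-valued mapping. The resolvent of a maximal monotone $\mathcal{M}$ with parameter $\lambda>0$ is the single-valued mapping $\mathfrak{J}^{\mathcal{M}}_\lambda=(I+\lambda\mathcal{M})^{-1}$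 defined on all of $\mathcal{H}$. $I$ is the identity. $\Omega$ is the solution set of the split monotone inclusion problem: $$\Omega=\{x^*\in\mathcal{H}_1:\ 0\in g_1(x^* )+\mathcal{B}_1(x^* )\ \text{and}\ 0\in g_2(\mathcal{A}x^* )+\mathcal{B}_2(\mathcal{A}x^* )\}.$$ Let $C$ be a subset of a metric space $(X,d)$. A mapping $T:C\to C$ is semicompact if every sequence $\{x_n\}$ in $C$ with $\lim_{n\to\infty}d(x_n,T(x_n))=0$ has a subsequence $\{x_{n_k}\}$ converging to some $p\in C$. *)

theory Defs
  imports "HOL-Analysis.Analysis"
begin

definition nonexpansive :: "('a::real_normed_vector \<Rightarrow> 'a) \<Rightarrow> bool" where
  "nonexpansive T \<longleftrightarrow> (\<forall>x y. norm (T x - T y) \<le> norm (x - y))"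

definition fixed_points :: "('a \<Rightarrow> 'a) \<Rightarrow> 'a set" where
  "fixed_points T = {x. T x = x}"

definition inverse_strongly_monotone :: "real \<Rightarrow> ('a::real_inner \<Rightarrow> 'a) \<Rightarrow> bool" where
  "inverse_strongly_monotone \<beta> g \<longleftrightarrow>
     \<beta> > 0 \<and> (\<forall>x y. (g x - g y) \<bullet> (x - y) \<ge> \<beta> * (norm (g x - g y))\<^sup>2)"

definition monotone_operator :: "('a::real_inner \<Rightarrow> 'a set) \<Rightarrow> bool" where
  "monotone_operator M \<longleftrightarrow>
     (\<forall>x y. \<forall>u\<in>M x. \<forall>v\<in>M y. (x - y) \<bullet> (u - v) \<ge> 0)"

definition maximal_monotone :: "('a::real_inner \<Rightarrow> 'a set) \<Rightarrow> bool" where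
  "maximal_monotone M \<longleftrightarrow>
     monotone_operator M \<and>
     \<not> (\<exists>N. monotone_operator N \<and> Sigma UNIV M \<subset> Sigma UNIV N)"

(* The value at z is the x with z in x + lam M(x).  For a maximal monotone M on a
   Hilbert space and lam > 0 there is exactly one such x for every z (Minty); the
   description is unspecified at z otherwise. *)
definition resolvent :: "real \<Rightarrow> ('a::real_inner \<Rightarrow> 'a set) \<Rightarrow> 'a \<Rightarrow> 'a" where
  "resolvent lam M z = (THE x. z \<in> {x + lam *\<^sub>R u | u. u \<in> M x})"

definition split_inclusion_solutions ::
  "('a::real_inner \<Rightarrow> 'a) \<Rightarrow> ('a \<Rightarrow> 'a set) \<Rightarrow> ('b::real_inner \<Rightarrow> 'b) \<Rightarrow> ('b \<Rightarrow> 'b set)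
     \<Rightarrow> ('a \<Rightarrow> 'b) \<Rightarrow> 'a set" where
  "split_inclusion_solutions g1 B1 g2 B2 A =
     {x. 0 \<in> {g1 x + u | u. u \<in> B1 x} \<and> 0 \<in> {g2 (A x) + v | v. v \<in> B2 (A x)}}"

definition semicompact_on :: "'a::metric_space set \<Rightarrow> ('a \<Rightarrow> 'a) \<Rightarrow> bool" where
  "semicompact_on C T \<longleftrightarrow>
     T ` C \<subseteq> C \<and>
     (\<forall>x :: nat \<Rightarrow> 'a. (\<forall>n. x n \<in> C) \<longrightarrow> (\<lambda>n. dist (x n) (T (x n))) \<longlonglongrightarrow> 0 \<longrightarrow>
        (\<exists>r p. strict_mono r \<and> p \<in> C \<and> (x \<circ> r) \<longlonglongrightarrow> p))"

end

(* A common zero of the two inclusions is a fixed point of J', because the resolvents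
   fix it and the adjoint of A (which exists by the Riesz theorem) vanishes at 0.
   For a common fixed point p of S and J' the distances |x n - p| decrease up to a
   summable error, hence converge. The identity for the norm of a convex combination
   then forces S (w n) - w n and S (y n) - J' (y n) to tend to 0, so that y n is an
   approximate fixed point sequence of both maps. Semicompactness yields a cluster
   point q, which is a common fixed point, and convergence of |x n - q| turns the
   subsequential limit into a limit. *)

theory Submission
  imports Defs
begin

section \<open>Riesz representation and adjoints in complete spaces\<close>

text \<open>A minimizing sequence of \<open>\<phi>\<close> is Cauchy by the parallelogram law, so
  completeness supplies a minimizer \<open>z\<close>; minimality along every line through
  \<open>z\<close> forces the representation.\<close>

lemma Riesz_representation:
  fixes f :: "'a::{real_inner, complete_space} \<Rightarrow> real"
  assumes "bounded_linear f"
  obtains z where "\<And>x. f x = z \<bullet> x"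
proof -
  interpret bounded_linear f by fact
  obtain K where K: "\<And>x. norm (f x) \<le> norm x * K"
    using bounded by blast
  \<comment> \<open>the representing vector is the minimizer of this quadratic functional\<close>
  define \<phi> where "\<phi> x = (norm x)\<^sup>2 - 2 * f x" for x
  define m where "m = Inf (range \<phi>)"
  have lower: "\<phi> x \<ge> - K\<^sup>2" for x
  proof -
    have "f x \<le> norm x * K"
      using K[of x] by simp
    moreover have "0 \<le> (norm x - K)\<^sup>2" by simp
    ultimately show ?thesis
      unfolding \<phi>_def power2_diff by linarith
  qed
  then have bdd: "bdd_below (range \<phi>)"
    by (intro bdd_belowI[of _ "- K\<^sup>2"]) auto
  then have m_le: "m \<le> \<phi> x" for x
    unfolding m_def by (intro cInf_lower) auto
  have "\<exists>x. \<phi> x < m + inverse (real (Suc n))" for n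
    using cInf_lessD[of "range \<phi>" "m + inverse (real (Suc n))"] by (auto simp: m_def)
  then obtain X where X: "\<And>n. \<phi> (X n) < m + inverse (real (Suc n))"
    by metis
  \<comment> \<open>Parallelogram law with midpoint \<open>h\<close>: the linear terms cancel, and
    \<open>\<phi> h\<close> is at least \<open>m\<close>.\<close>
  have para: "(norm (a - b))\<^sup>2 \<le> 2 * (\<phi> a - m) + 2 * (\<phi> b - m)" for a b
  proof -
    define h where "h = (1/2) *\<^sub>R (a + b)"
    have "(norm (a - b))\<^sup>2 = 2 * \<phi> a + 2 * \<phi> b - 4 * \<phi> h"
      unfolding \<phi>_def h_def power2_norm_eq_inner
      by (simp add: scaleR add algebra_simps inner_commute)
    then show ?thesis
      using m_le[of h] by argo
  qed
  have "Cauchy X"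
  proof (rule metric_CauchyI)
    fix e :: real assume "e > 0"
    \<comment> \<open>The factor 1/4 is chosen because \<open>para\<close> doubles each of two
      excesses over \<open>m\<close>.\<close>
    then obtain N where N: "inverse (real (Suc N)) < e\<^sup>2 / 4"
      using reals_Archimedean[of "e\<^sup>2 / 4"] by auto
    have small: "\<phi> (X n) - m < e\<^sup>2 / 4" if "n \<ge> N" for n
    proof -
      have "inverse (real (Suc n)) \<le> inverse (real (Suc N))"
        using that by (intro le_imp_inverse_le) auto
      then show ?thesis
        using X[of n] N by linarith
    qed
    have "dist (X i) (X j) < e" if "i \<ge> N" "j \<ge> N" for i j
    proof -
      have "(norm (X i - X j))\<^sup>2 < e\<^sup>2"
        using para[of "X i" "X j"] small[OF that(1)] small[OF that(2)] by argo
      then show ?thesis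
        using \<open>e > 0\<close> by (simp add: dist_norm power2_less_imp_less)
    qed
    then show "\<exists>M. \<forall>i\<ge>M. \<forall>j\<ge>M. dist (X i) (X j) < e"
      by blast
  qed
  then obtain z where z: "X \<longlonglongrightarrow> z"
    using Cauchy_convergent convergent_def by blast
  have "(\<lambda>n. \<phi> (X n)) \<longlonglongrightarrow> \<phi> z"
    unfolding \<phi>_def by (intro tendsto_intros tendsto z)
  moreover have "(\<lambda>n. m + inverse (real (Suc n))) \<longlonglongrightarrow> m + 0"
    by (intro tendsto_intros LIMSEQ_inverse_real_of_nat)
  ultimately have "\<phi> z \<le> m + 0"
    by (rule LIMSEQ_le) (use X less_imp_le in blast)
  then have min: "\<phi> z \<le> \<phi> x" for x
    using m_le[of x] by simp
  have "f x = z \<bullet> x" for x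
  proof (cases "x = 0")
    case True
    then show ?thesis by (simp add: zero)
  next
    case False
    define d where "d = f x - z \<bullet> x"
    \<comment> \<open>This \<open>t\<close> minimizes \<open>\<phi> (z + s *\<^sub>R x)\<close> over
      real \<open>s\<close> and lowers \<open>\<phi> z\<close> by
      \<open>d\<^sup>2 / (x \<bullet> x)\<close>; as \<open>z\<close> is a minimizer,
      \<open>d\<close> must vanish.\<close>
    define t where "t = d / (x \<bullet> x)"
    have t: "t * (x \<bullet> x) = d"
      using False by (simp add: t_def)
    have "0 \<le> \<phi> (z + t *\<^sub>R x) - \<phi> z"
      using min by simp
    also have "\<dots> = t * (t * (x \<bullet> x)) - 2 * t * d"
      unfolding \<phi>_def power2_norm_eq_inner d_def
      by (simp add: scaleR add algebra_simps inner_commute)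
    also have "\<dots> = - (t * d)"
      by (simp add: t)
    finally have "t * d \<le> 0" by simp
    then have "d\<^sup>2 / (x \<bullet> x) \<le> 0"
      by (simp add: t_def power2_eq_square)
    moreover have "x \<bullet> x > 0"
      using False by simp
    ultimately have "d = 0"
      by (simp add: divide_le_0_iff)
    then show ?thesis
      by (simp add: d_def)
  qed
  then show ?thesis
    using that by blast
qed

\<comment> \<open>In infinite dimension the library's \<open>adjoint\<close>, defined by a choice, is
  meaningful only once existence is known.\<close>
lemma adjoint_works_complete:
  fixes A :: "'a::{real_inner, complete_space} \<Rightarrow> 'b::real_inner"
  assumes "bounded_linear A"
  shows "x \<bullet> adjoint A y = A x \<bullet> y"
proof -
  have "\<exists>z. \<forall>x. A x \<bullet> y = x \<bullet> z" for y
  proof -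
    have "bounded_linear (\<lambda>x. A x \<bullet> y)"
      by (rule bounded_linear_compose[OF bounded_linear_inner_left assms])
    then obtain z where "\<And>x. A x \<bullet> y = z \<bullet> x"
      by (rule Riesz_representation) blast
    then show ?thesis
      by (auto simp: inner_commute)
  qed
  then have "\<exists>f'. \<forall>x y. A x \<bullet> y = x \<bullet> f' y"
    by metis
  then have "\<forall>x y. A x \<bullet> y = x \<bullet> adjoint A y"
    unfolding adjoint_def by (rule someI_ex)
  then show ?thesis by simp
qed

lemma adjoint_zero_complete:
  fixes A :: "'a::{real_inner, complete_space} \<Rightarrow> 'b::real_inner"
  assumes "bounded_linear A"
  shows "adjoint A 0 = 0"
  using adjoint_works_complete[OF assms, of "adjoint A 0" 0] by simp

section \<open>Resolvents and forward-backward steps\<close>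

text \<open>If \<open>x\<close> with \<open>u\<close> and \<open>x'\<close> with \<open>v\<close>
  both solve the inclusion for \<open>z\<close>, then \<open>x' - x = lam *\<^sub>R (u - v)\<close>,
  and monotonicity makes the squared norm of \<open>x' - x\<close> nonpositive. Hence the definite
  description denotes \<open>x\<close>.\<close>

lemma resolvent_eqI:
  assumes "monotone_operator M" "lam > 0" "u \<in> M x" "z = x + lam *\<^sub>R u"
  shows "resolvent lam M z = x"
  unfolding resolvent_def
proof (rule the_equality)
  show "z \<in> {x + lam *\<^sub>R u | u. u \<in> M x}"
    using assms by blast
next
  fix x' assume "z \<in> {x' + lam *\<^sub>R u | u. u \<in> M x'}"
  then obtain v where v: "v \<in> M x'" "z = x' + lam *\<^sub>R v"
    by blast
  have "x' - x = lam *\<^sub>R (u - v)"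
    using v(2) assms(4) by (simp add: algebra_simps)
  moreover have "(x - x') \<bullet> (u - v) \<ge> 0"
    using assms v(1) unfolding monotone_operator_def by blast
  ultimately have "(x' - x) \<bullet> (x' - x) \<le> 0"
    using \<open>lam > 0\<close> by (metis inner_minus_left inner_scaleR_right minus_diff_eq
        mult_le_0_iff neg_le_0_iff_le less_imp_le inner_commute)
  then show "x' = x"
    by (metis eq_iff_diff_eq_0 inner_eq_zero_iff inner_ge_zero order_antisym)
qed

text \<open>The inclusion says that \<open>- g x\<close> lies in \<open>M x\<close>, so this is the
  previous lemma with \<open>u = - g x\<close>.\<close>

lemma resolvent_forward_step:
  assumes "monotone_operator M" "lam > 0" "0 \<in> {g x + u | u. u \<in> M x}"
  shows "resolvent lam M (x - lam *\<^sub>R g x) = x"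
proof -
  have "- g x \<in> M x"
    using assms(3) by (auto simp: eq_neg_iff_add_eq_0 add.commute minus_unique)
  then show ?thesis
    by (rule resolvent_eqI[OF assms(1,2)]) simp
qed

section \<open>Nonexpansive maps and convex combinations\<close>

lemma nonexpansive_tendsto:
  assumes "nonexpansive T" "(X \<longlongrightarrow> q) F"
  shows "((\<lambda>n. T (X n)) \<longlongrightarrow> T q) F"
proof (rule Lim_null_comparison[THEN LIM_zero_cancel])
  show "\<forall>\<^sub>F n in F. norm (T (X n) - T q) \<le> norm (X n - q)"
    using assms(1) by (simp add: nonexpansive_def)
  show "((\<lambda>n. norm (X n - q)) \<longlongrightarrow> 0) F"
    using assms(2) by (simp add: LIM_zero tendsto_norm_zero)
qed

lemma nonexpansive_dist_fixed:
  assumes "nonexpansive T" "T p = p"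
  shows "norm (T x - p) \<le> norm (x - p)"
  using assms unfolding nonexpansive_def by metis

lemma norm_convex_combination_sq:
  fixes a b p :: "'a::real_inner"
  shows "(norm ((1 - t) *\<^sub>R a + t *\<^sub>R b - p))\<^sup>2 =
    (1 - t) * (norm (a - p))\<^sup>2 + t * (norm (b - p))\<^sup>2 - t * (1 - t) * (norm (a - b))\<^sup>2"
  unfolding power2_norm_eq_inner
  by (simp add: algebra_simps inner_commute)

text \<open>A weight at distance at least \<open>\<delta>\<close> from both 0 and 1 has
  \<open>t * (1 - t) \<ge> \<delta>\<^sup>2\<close>, so the gain from uniform convexity does not
  depend on \<open>t\<close>.\<close>

lemma norm_convex_combination_sq_le:
  fixes a b p :: "'a::real_inner"
  assumes "0 < \<delta>" "t \<in> {\<delta>..1 - \<delta>}" "norm (a - p) \<le> r" "norm (b - p) \<le> r"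
  shows "(norm ((1 - t) *\<^sub>R a + t *\<^sub>R b - p))\<^sup>2 + \<delta>\<^sup>2 * (norm (a - b))\<^sup>2 \<le> r\<^sup>2"
proof -
  have t: "\<delta> \<le> t" "\<delta> \<le> 1 - t" "0 \<le> t" "0 \<le> 1 - t"
    using assms by auto
  have "(1 - t) * (norm (a - p))\<^sup>2 \<le> (1 - t) * r\<^sup>2" "t * (norm (b - p))\<^sup>2 \<le> t * r\<^sup>2"
    using assms t by (auto intro!: mult_left_mono power_mono)
  moreover have "\<delta> * \<delta> * (norm (a - b))\<^sup>2 \<le> t * (1 - t) * (norm (a - b))\<^sup>2"
    using assms t by (intro mult_right_mono mult_mono) auto
  ultimately show ?thesis
    unfolding norm_convex_combination_sq by (simp add: power2_eq_square algebra_simps)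
qed

section \<open>Convergence criteria for sequences\<close>

text \<open>Subtracting the partial sums of the errors leaves a decreasing sequence bounded below by
  \<open>- suminf e\<close>; adding them back preserves convergence.\<close>

lemma convergent_almost_decreasing:
  fixes a e :: "nat \<Rightarrow> real"
  assumes "\<And>n. 0 \<le> a n" "\<And>n. 0 \<le> e n" "summable e" "\<And>n. a (Suc n) \<le> a n + e n"
  shows "convergent a"
proof -
  define b where "b n = a n - (\<Sum>k<n. e k)" for n
  have "decseq b"
    using assms(4) by (intro decseq_SucI) (simp add: b_def algebra_simps)
  moreover have "- suminf e \<le> b n" for n
    using sum_le_suminf[OF assms(3), of "{..<n}"] assms(1)[of n] assms(2)
    by (simp add: b_def)
  ultimately obtain L where "b \<longlonglongrightarrow> L"
    using decseq_convergent by blast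
  then have "(\<lambda>n. b n + (\<Sum>k<n. e k)) \<longlonglongrightarrow> L + suminf e"
    using assms(3) by (intro tendsto_add summable_LIMSEQ)
  then show ?thesis
    unfolding b_def convergent_def by auto
qed

text \<open>The gap between the squares of \<open>d\<close> and \<open>c\<close> dominates the
  squared norm of \<open>\<delta> *\<^sub>R u n\<close>, and it vanishes because the limits
  agree.\<close>

lemma tendsto_zero_of_sq_gap:
  fixes u :: "nat \<Rightarrow> 'a::real_normed_vector" and c d :: "nat \<Rightarrow> real"
  assumes "0 < \<delta>" "\<And>n. (c n)\<^sup>2 + \<delta>\<^sup>2 * (norm (u n))\<^sup>2 \<le> (d n)\<^sup>2" "c \<longlonglongrightarrow> l" "d \<longlonglongrightarrow> l"
  shows "u \<longlonglongrightarrow> 0"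
proof -
  have "(\<lambda>n. (d n)\<^sup>2 - (c n)\<^sup>2) \<longlonglongrightarrow> l\<^sup>2 - l\<^sup>2"
    by (intro tendsto_intros assms)
  then have "(\<lambda>n. sqrt ((d n)\<^sup>2 - (c n)\<^sup>2)) \<longlonglongrightarrow> 0"
    using tendsto_real_sqrt by fastforce
  moreover have "norm (\<delta> *\<^sub>R u n) \<le> sqrt ((d n)\<^sup>2 - (c n)\<^sup>2)" for n
    using assms(1) assms(2)[of n] by (intro real_le_rsqrt) (simp add: power_mult_distrib)
  ultimately have "(\<lambda>n. \<delta> *\<^sub>R u n) \<longlonglongrightarrow> 0"
    by (intro Lim_null_comparison[of "\<lambda>n. \<delta> *\<^sub>R u n"]) auto
  then have "(\<lambda>n. inverse \<delta> *\<^sub>R \<delta> *\<^sub>R u n) \<longlonglongrightarrow> inverse \<delta> *\<^sub>R 0"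
    by (intro tendsto_intros)
  then show ?thesis
    using assms(1) by simp
qed

section \<open>The perturbed two-step iteration\<close>

text \<open>The scheme detached from the operators: \<open>T\<close> stands for \<open>J'\<close>,
  and the inertial term enters only as a summable perturbation \<open>e\<close>.\<close>

locale perturbed_two_step_iteration =
  fixes S T :: "'a::real_inner \<Rightarrow> 'a"
    and X W Y :: "nat \<Rightarrow> 'a" and a b e :: "nat \<Rightarrow> real" and \<delta> :: real
  assumes S: "nonexpansive S" and T: "nonexpansive T"
    and \<delta>: "0 < \<delta>" and a: "\<And>n. a n \<in> {\<delta>..1 - \<delta>}" and b: "\<And>n. b n \<in> {\<delta>..1 - \<delta>}"
    and e: "summable e" and W: "\<And>n. norm (W n - X n) \<le> e n"
    and Y: "\<And>n. Y n = (1 - b n) *\<^sub>R W n + b n *\<^sub>R S (W n)"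
    and X: "\<And>n. X (Suc n) = (1 - a n) *\<^sub>R S (Y n) + a n *\<^sub>R T (Y n)"
begin

lemma W_le:
  shows "norm (W n - p) \<le> norm (X n - p) + e n"
  using norm_triangle_ineq[of "W n - X n" "X n - p"] W[of n] by simp

text \<open>Both \<open>W n\<close> and its image under \<open>S\<close> lie within
  \<open>norm (W n - p)\<close> of \<open>p\<close>. The gap term is kept because it later yields
  the vanishing of \<open>W n - S (W n)\<close>.\<close>

lemma Y_le:
  assumes "S p = p"
  shows "(norm (Y n - p))\<^sup>2 + \<delta>\<^sup>2 * (norm (W n - S (W n)))\<^sup>2 \<le> (norm (W n - p))\<^sup>2"
  unfolding Y by (rule norm_convex_combination_sq_le[OF \<delta> b])
    (auto intro: nonexpansive_dist_fixed S assms)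

lemma X_le:
  assumes "S p = p" "T p = p"
  shows "(norm (X (Suc n) - p))\<^sup>2 + \<delta>\<^sup>2 * (norm (S (Y n) - T (Y n)))\<^sup>2 \<le> (norm (Y n - p))\<^sup>2"
  unfolding X by (rule norm_convex_combination_sq_le[OF \<delta> a])
    (auto intro: nonexpansive_dist_fixed S T assms)

lemma Y_le_W:
  assumes "S p = p"
  shows "norm (Y n - p) \<le> norm (W n - p)"
proof (rule power2_le_imp_le)
  have "0 \<le> \<delta>\<^sup>2 * (norm (W n - S (W n)))\<^sup>2" by simp
  then show "(norm (Y n - p))\<^sup>2 \<le> (norm (W n - p))\<^sup>2"
    using Y_le[OF assms, of n] by linarith
qed simp

lemma X_le_Y:
  assumes "S p = p" "T p = p"
  shows "norm (X (Suc n) - p) \<le> norm (Y n - p)"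
proof (rule power2_le_imp_le)
  have "0 \<le> \<delta>\<^sup>2 * (norm (S (Y n) - T (Y n)))\<^sup>2" by simp
  then show "(norm (X (Suc n) - p))\<^sup>2 \<le> (norm (Y n - p))\<^sup>2"
    using X_le[OF assms, of n] by linarith
qed simp

text \<open>From \<open>X (Suc n)\<close> back through \<open>Y n\<close> and \<open>W n\<close> to
  \<open>X n\<close>, the distance to \<open>p\<close> grows by at most \<open>e n\<close>. The
  point \<open>p\<close> is arbitrary so that the cluster point found later can take its
  place.\<close>

lemma dist_convergent:
  assumes "S p = p" "T p = p"
  obtains l where "(\<lambda>n. norm (X n - p)) \<longlonglongrightarrow> l"
proof -
  have "convergent (\<lambda>n. norm (X n - p))"
  proof (rule convergent_almost_decreasing[OF _ _ e])
    show "0 \<le> e n" for n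
      using order_trans[OF norm_ge_zero W] .
    show "norm (X (Suc n) - p) \<le> norm (X n - p) + e n" for n
      using X_le_Y[OF assms, of n] Y_le_W[OF assms(1), of n] W_le[of n p] by linarith
  qed simp
  then show ?thesis
    using that convergent_def by blast
qed

lemma W_asymptotic: "(\<lambda>n. W n - X n) \<longlonglongrightarrow> 0"
  using W by (intro Lim_null_comparison[OF _ summable_LIMSEQ_zero[OF e]]) auto

text \<open>The distances of \<open>W n\<close> and \<open>Y n\<close> to \<open>p\<close> are
  squeezed between \<open>norm (X (Suc n) - p)\<close> and \<open>norm (X n - p) + e n\<close>, so
  all share one limit and the gap terms must vanish.\<close>

lemma
  assumes "S p = p" "T p = p"
  shows S_asymptotic: "(\<lambda>n. W n - S (W n)) \<longlonglongrightarrow> 0"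
    and S_T_asymptotic: "(\<lambda>n. S (Y n) - T (Y n)) \<longlonglongrightarrow> 0"
proof -
  obtain l where l: "(\<lambda>n. norm (X n - p)) \<longlonglongrightarrow> l"
    by (rule dist_convergent[OF assms])
  then have l': "(\<lambda>n. norm (X (Suc n) - p)) \<longlonglongrightarrow> l"
    by (rule LIMSEQ_Suc)
  have "(\<lambda>n. norm (X n - p) + e n) \<longlonglongrightarrow> l + 0"
    by (intro tendsto_add l summable_LIMSEQ_zero[OF e])
  then have up: "(\<lambda>n. norm (X n - p) + e n) \<longlonglongrightarrow> l" by simp
  have Wl: "(\<lambda>n. norm (W n - p)) \<longlonglongrightarrow> l"
    using W_le order_trans[OF X_le_Y[OF assms] Y_le_W[OF assms(1)]]
    by (intro tendsto_sandwich[OF always_eventually always_eventually l' up]) blast+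
  have Yl: "(\<lambda>n. norm (Y n - p)) \<longlonglongrightarrow> l"
    using Y_le_W[OF assms(1)] X_le_Y[OF assms]
    by (intro tendsto_sandwich[OF always_eventually always_eventually l' Wl]) blast+
  show "(\<lambda>n. W n - S (W n)) \<longlonglongrightarrow> 0"
    by (rule tendsto_zero_of_sq_gap[OF \<delta> Y_le[OF assms(1)] Yl Wl])
  show "(\<lambda>n. S (Y n) - T (Y n)) \<longlonglongrightarrow> 0"
    by (rule tendsto_zero_of_sq_gap[OF \<delta> X_le[OF assms] l' Yl])
qed

lemma Y_asymptotic:
  assumes "S p = p" "T p = p"
  shows "(\<lambda>n. Y n - W n) \<longlonglongrightarrow> 0"
proof (rule Lim_null_comparison)
  have "norm (Y n - W n) \<le> norm (W n - S (W n))" for n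
  proof -
    have "Y n - W n = - (b n *\<^sub>R (W n - S (W n)))"
      by (simp add: Y algebra_simps)
    moreover have "\<bar>b n\<bar> \<le> 1"
      using b[of n] \<delta> by auto
    ultimately show ?thesis
      by (simp add: mult_left_le_one_le)
  qed
  then show "\<forall>\<^sub>F n in sequentially. norm (Y n - W n) \<le> norm (W n - S (W n))"
    by simp
  show "(\<lambda>n. norm (W n - S (W n))) \<longlonglongrightarrow> 0"
    using S_asymptotic[OF assms] by (rule tendsto_norm_zero)
qed

text \<open>\<open>S\<close> and \<open>T\<close> are compared along \<open>Y\<close>, so the
  approximate fixed point property of \<open>S\<close> is carried over from \<open>W\<close> by a
  telescoping sum.\<close>

lemma S_Y_asymptotic:
  assumes "S p = p" "T p = p"
  shows "(\<lambda>n. Y n - S (Y n)) \<longlonglongrightarrow> 0"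
proof -
  have "(\<lambda>n. S (W n) - S (Y n)) \<longlonglongrightarrow> 0"
  proof (rule Lim_null_comparison)
    show "\<forall>\<^sub>F n in sequentially. norm (S (W n) - S (Y n)) \<le> norm (Y n - W n)"
      using S by (simp add: nonexpansive_def norm_minus_commute)
    show "(\<lambda>n. norm (Y n - W n)) \<longlonglongrightarrow> 0"
      using Y_asymptotic[OF assms] by (rule tendsto_norm_zero)
  qed
  then have "(\<lambda>n. (Y n - W n) + (W n - S (W n)) + (S (W n) - S (Y n))) \<longlonglongrightarrow> 0 + 0 + 0"
    by (intro tendsto_add Y_asymptotic[OF assms] S_asymptotic[OF assms])
  then show ?thesis by simp
qed

theorem converges_to_common_fixed_point:
  assumes "semicompact_on UNIV S" "S p = p" "T p = p"
  obtains q where "S q = q" "T q = q" "X \<longlonglongrightarrow> q"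
proof -
  note common = assms(2,3)
  have "(\<lambda>n. dist (Y n) (S (Y n))) \<longlonglongrightarrow> 0"
    using S_Y_asymptotic[OF common] by (simp add: dist_norm tendsto_norm_zero)
  then obtain r q where r: "strict_mono r" and Yq: "(Y \<circ> r) \<longlonglongrightarrow> q"
    using assms(1) unfolding semicompact_on_def by (metis UNIV_I)
  have sub: "(\<lambda>n. f (r n)) \<longlonglongrightarrow> c" if "f \<longlonglongrightarrow> c" for f :: "nat \<Rightarrow> 'a" and c
    using LIMSEQ_subseq_LIMSEQ[OF that r] by (simp add: o_def)
  have Yq: "(\<lambda>n. Y (r n)) \<longlonglongrightarrow> q"
    using Yq by (simp add: o_def)
  \<comment> \<open>The vanishing differences pass the limit \<open>q\<close> from \<open>Y\<close>
    to its images under \<open>S\<close> and then \<open>T\<close>; continuity of both maps makes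
    \<open>q\<close> a common fixed point.\<close>
  have SYq: "(\<lambda>n. S (Y (r n))) \<longlonglongrightarrow> q"
    using tendsto_diff[OF Yq sub[OF S_Y_asymptotic[OF common]]] by simp
  have TYq: "(\<lambda>n. T (Y (r n))) \<longlonglongrightarrow> q"
    using tendsto_diff[OF SYq sub[OF S_T_asymptotic[OF common]]] by simp
  have Sq: "S q = q"
    using LIMSEQ_unique[OF nonexpansive_tendsto[OF S Yq] SYq] .
  have Tq: "T q = q"
    using LIMSEQ_unique[OF nonexpansive_tendsto[OF T Yq] TYq] .
  have Xq: "(\<lambda>n. X (r n)) \<longlonglongrightarrow> q"
    using tendsto_diff[OF tendsto_diff[OF Yq sub[OF Y_asymptotic[OF common]]] sub[OF W_asymptotic]]
    by simp
  \<comment> \<open>Now \<open>q\<close> itself serves as the reference point, and the subsequence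
    identifies \<open>l\<close> as 0.\<close>
  obtain l where l: "(\<lambda>n. norm (X n - q)) \<longlonglongrightarrow> l"
    by (rule dist_convergent[OF Sq Tq])
  then have "(\<lambda>n. norm (X (r n) - q)) \<longlonglongrightarrow> l"
    using LIMSEQ_subseq_LIMSEQ[OF l r] by (simp add: o_def)
  moreover have "(\<lambda>n. norm (X (r n) - q)) \<longlonglongrightarrow> 0"
    using Xq by (simp add: LIM_zero tendsto_norm_zero)
  ultimately have "l = 0"
    by (rule LIMSEQ_unique)
  then have "X \<longlonglongrightarrow> q"
    using l by (simp add: tendsto_norm_zero_iff LIM_zero_iff)
  then show ?thesis
    using that Sq Tq by blast
qed

end

section \<open>Application to the split monotone inclusion problem\<close>

theorem theorem3p4:
  fixes g1 :: "'h1::{real_inner, complete_space} \<Rightarrow> 'h1"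
    and g2 :: "'h2::{real_inner, complete_space} \<Rightarrow> 'h2"
    and B1 :: "'h1 \<Rightarrow> 'h1 set"
    and B2 :: "'h2 \<Rightarrow> 'h2 set"
    and A :: "'h1 \<Rightarrow> 'h2"
    and S U J' :: "'h1 \<Rightarrow> 'h1"
    and V :: "'h2 \<Rightarrow> 'h2"
    and \<mu> \<nu> lam \<gamma> \<theta>' \<delta> :: real
    and \<Sigma> :: "'h1 set"
    and x w y :: "nat \<Rightarrow> 'h1"
    and \<theta> \<alpha> \<beta> :: "nat \<Rightarrow> real"
  assumes g1: "inverse_strongly_monotone \<mu> g1"
    and g2: "inverse_strongly_monotone \<nu> g2"
    and B1: "maximal_monotone B1"
    and B2: "maximal_monotone B2"
    and A: "bounded_linear A"
    and lam: "lam > 0"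
    and \<gamma>: "ereal \<gamma> \<in> {0<..<2 / ereal (onorm (adjoint A \<circ> A))}"
    and U: "U = (\<lambda>z. resolvent lam B1 (z - lam *\<^sub>R g1 z))"
    and V: "V = (\<lambda>z. resolvent lam B2 (z - lam *\<^sub>R g2 z))"
    and J': "J' = (\<lambda>z. U (z + \<gamma> *\<^sub>R adjoint A (V (A z) - A z)))"
    and S_nonexp: "nonexpansive S"
    and J'_nonexp: "nonexpansive J'"
    and \<Sigma>: "\<Sigma> = fixed_points S \<inter> split_inclusion_solutions g1 B1 g2 B2 A"
    and \<Sigma>_nonempty: "\<Sigma> \<noteq> {}"
    and S_semicompact: "semicompact_on UNIV S"
    and w: "\<And>n. n \<ge> 1 \<Longrightarrow> w n = x n + \<theta> n *\<^sub>R (x n - x (n - 1))"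
    and y: "\<And>n. n \<ge> 1 \<Longrightarrow> y n = (1 - \<beta> n) *\<^sub>R w n + \<beta> n *\<^sub>R S (w n)"
    and x: "\<And>n. n \<ge> 1 \<Longrightarrow> x (n + 1) = (1 - \<alpha> n) *\<^sub>R S (y n) + \<alpha> n *\<^sub>R J' (y n)"
    and D1: "summable (\<lambda>n. \<theta> (n + 1))" "0 \<le> \<theta>'" "\<theta>' < 1" "\<And>n. n \<ge> 1 \<Longrightarrow> \<theta> n \<in> {0..\<theta>'}"
    and D2: "\<delta> \<in> {0<..<0.5}"
      "\<And>n. n \<ge> 1 \<Longrightarrow> \<alpha> n \<in> {\<delta>..1 - \<delta>}" "\<And>n. n \<ge> 1 \<Longrightarrow> \<beta> n \<in> {\<delta>..1 - \<delta>}"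
    and D3: "bounded {S (w n) - w n | n. n \<ge> 1}"
      "\<And>p. p \<in> \<Sigma> \<Longrightarrow> bounded {S (w n) - p | n. n \<ge> 1}"
    and D4: "bounded {J' (w n) - w n | n. n \<ge> 1}"
      "\<And>p. p \<in> \<Sigma> \<Longrightarrow> bounded {J' (w n) - p | n. n \<ge> 1}"
  shows "\<exists>p \<in> fixed_points S \<inter> fixed_points J'. x \<longlonglongrightarrow> p"
proof -
  obtain p where p: "p \<in> \<Sigma>" using \<Sigma>_nonempty by blast
  have Sp: "S p = p" and p_sol: "p \<in> split_inclusion_solutions g1 B1 g2 B2 A"
    using p by (auto simp: \<Sigma> fixed_points_def)
  have mono: "monotone_operator B1" "monotone_operator B2"
    using B1 B2 by (auto simp: maximal_monotone_def)
  have zero: "0 \<in> {g1 p + u | u. u \<in> B1 p}" "0 \<in> {g2 (A p) + v | v. v \<in> B2 (A p)}"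
    using p_sol unfolding split_inclusion_solutions_def mem_Collect_eq by blast+
  have "U p = p" "V (A p) = A p"
    unfolding U V using resolvent_forward_step mono lam zero by blast+
  then have J'p: "J' p = p"
    by (simp add: J' adjoint_zero_complete[OF A])

  \<comment> \<open>Both bounds of (D3) are used: \<open>w n - p\<close> is the difference of
    \<open>S (w n) - p\<close> and \<open>S (w n) - w n\<close>.\<close>
  obtain K1 K2 where K: "\<And>n. n \<ge> 1 \<Longrightarrow> norm (S (w n) - w n) \<le> K1"
      "\<And>n. n \<ge> 1 \<Longrightarrow> norm (S (w n) - p) \<le> K2"
    using D3(1) D3(2)[OF p] unfolding bounded_iff by blast
  have w_bound: "norm (w n - p) \<le> K1 + K2" if "n \<ge> 1" for n
    using norm_triangle_ineq4[of "S (w n) - p" "S (w n) - w n"] K[OF that] by simp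
  have "0 < \<delta>" using D2(1) by simp
  \<comment> \<open>Balls around \<open>p\<close> are convex; the gap term is simply
    dropped.\<close>
  have cvx: "norm ((1 - t) *\<^sub>R u + t *\<^sub>R v - p) \<le> r"
    if "t \<in> {\<delta>..1 - \<delta>}" "norm (u - p) \<le> r" "norm (v - p) \<le> r" for t u v r
  proof (rule power2_le_imp_le)
    have "0 \<le> \<delta>\<^sup>2 * (norm (u - v))\<^sup>2" by simp
    then show "(norm ((1 - t) *\<^sub>R u + t *\<^sub>R v - p))\<^sup>2 \<le> r\<^sup>2"
      using norm_convex_combination_sq_le[OF \<open>0 < \<delta>\<close> that] by linarith
    show "0 \<le> r"
      using that(2) norm_ge_zero order_trans by blast
  qed
  have x_bound: "norm (x (n + 1) - p) \<le> K1 + K2" if "n \<ge> 1" for n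
  proof -
    have "norm (S (w n) - p) \<le> K1 + K2"
      using nonexpansive_dist_fixed[OF S_nonexp Sp] w_bound[OF that] order_trans by blast
    then have "norm (y n - p) \<le> K1 + K2"
      unfolding y[OF that] by (intro cvx D2(3) w_bound that)
    then have "norm (S (y n) - p) \<le> K1 + K2" "norm (J' (y n) - p) \<le> K1 + K2"
      using nonexpansive_dist_fixed[OF S_nonexp Sp] nonexpansive_dist_fixed[OF J'_nonexp J'p]
        order_trans by blast+
    then show ?thesis
      unfolding x[OF that] by (intro cvx D2(2) that)
  qed
  \<comment> \<open>\<open>x_bound\<close> covers the indices from 2 on, so the two initial points
    enter the maximum separately.\<close>
  define K where "K = max (K1 + K2) (max (norm (x 0 - p)) (norm (x 1 - p)))"
  have x_le: "norm (x n - p) \<le> K" for n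
  proof -
    consider "n = 0" | "n = 1" | "n - 1 \<ge> 1" by linarith
    then show ?thesis
      using x_bound[of "n - 1"] by cases (auto simp: K_def)
  qed
  have step: "norm (x (n + 1) - x n) \<le> 2 * K" for n
    using norm_triangle_ineq4[of "x (n + 1) - p" "x n - p"] x_le[of "n + 1"] x_le[of n] by simp

  \<comment> \<open>The recursion holds from index 1 and the locale counts from 0, hence the shift.
    Since consecutive iterates are at most \<open>2 * K\<close> apart, (D1) makes the inertial terms
    summable.\<close>
  interpret perturbed_two_step_iteration S J' "\<lambda>n. x (n + 1)" "\<lambda>n. w (n + 1)" "\<lambda>n. y (n + 1)"
    "\<lambda>n. \<alpha> (n + 1)" "\<lambda>n. \<beta> (n + 1)" "\<lambda>n. \<theta> (n + 1) * (2 * K)" \<delta>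
  proof
    show "norm (w (n + 1) - x (n + 1)) \<le> \<theta> (n + 1) * (2 * K)" for n
      using w[of "n + 1"] D1(4)[of "n + 1"] step[of n] by (simp add: mult_left_mono)
    show "summable (\<lambda>n. \<theta> (n + 1) * (2 * K))"
      by (intro summable_mult2 D1(1))
    show "x (Suc n + 1) = (1 - \<alpha> (n + 1)) *\<^sub>R S (y (n + 1)) + \<alpha> (n + 1) *\<^sub>R J' (y (n + 1))" for n
      using x[of "n + 1"] by simp
  qed (simp_all only: \<open>0 < \<delta>\<close> S_nonexp J'_nonexp D2 y le_add2)
  obtain q where q: "S q = q" "J' q = q" "(\<lambda>n. x (n + 1)) \<longlonglongrightarrow> q"
    by (rule converges_to_common_fixed_point[OF S_semicompact Sp J'p])
  then have "x \<longlonglongrightarrow> q"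
    using LIMSEQ_imp_Suc by fastforce
  then show ?thesis
    using q by (auto simp: fixed_points_def)
qed

end
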